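(* Let $n\ge 2$ and $2^{n-2}<k\le 2^{n-1}$. Let $H_1,\dots,H_{h(n,k)}$ be representatives of the equivalence classes (under $B_n$) of spanned hyperplanes of $Q_n$ containing at least $k$ points of $V_n$. Define $\Phi$ on the disjoint union $\bigsqcup_{i=1}^{h(n,k)}\mathcal{P}(H_i,k)$ by sending a partial $0/1$-equivalence class $\mathcal{P}_i\in\mathcal{P}(H_i,k)$ to the unique $0/1$-equivalence class of $Q_n$ containing it. Then $\Phi$ is a bijection from $\bigsqcup_{i=1}^{h(n,k)}\mathcal{P}(H_i,k)$ onto $\mathcal{H}_n(k)$.
   Context: $Q_n=[0,1]^n$, $V_n=\{0,1\}^n$. A $0/1$-polytope of $Q_n$ is the convex hull of a nonempty subset of $V_n$; it has $k$ vertices if that subset has $k$ elements. $B_n$ is the group of signed permutations $w$ of $\{1,\dots,n\}$ (underlying permutation $\pi$, sign $\pm$ attached to each $i$), acting on $\mathbb{R}^n$ by $w(x)_i=x_{\pi(i)}$ if $i$ has sign $+$ and $w(x)_i=1-x_{\pi(i)}$ if $i$ has sign $-$; $w$ acts on subsets of $\mathbb{R}^n$ by taking images. Two $0/1$-polytopes are $0/1$-equivalent if one is the image of the other under some $w\in B_n$; two subsets of $\mathbb{R}^n$ (e.g. hyperplanes) are equivalent if one is the image of the other under some $w\in B_n$. A spanned hyperplane of $Q_n$ is a hyperplane $H\subset\mathbb{R}^n$ such that the affine hull of $H\cap V_n$ equals $H$. For a set $\mathcal S\subset\mathbb{R}^n$, the partial $0/1$-equivalence classes of $\mathcal S$ are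 the classes of the restriction of $0/1$-equivalence to the set of $0/1$-polytopes contained in $\mathcal S$ (two such polytopes are equivalent iff some $w\in B_n$ maps one onto the other); $\mathcal{P}(\mathcal S,k)$ is the set of those classes whose polytopes have $k$ vertices. $\mathcal{H}_n(k)$ is the set of $0/1$-equivalence classes of $0/1$-polytopes of $Q_n$ with $k$ vertices that are not full-dimensional. *)

theory Defs
  imports "HOL-Analysis.Analysis"
begin

text \<open>
  The coordinates $1, \dots, n$ are rendered by a finite index type \<open>'n\<close>, so that
  $n$ is \<open>CARD('n)\<close> and $\mathbb{R}^n$ is \<open>real ^ 'n\<close>.
\<close>

definition cube_vertices :: "(real ^ 'n) set" where
  "cube_vertices = {x. \<forall>i. x $ i \<in> {0, 1}}"

text \<open>
  A signed permutation is given by its underlying permutation \<open>\<pi>\<close> and its signs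
  \<open>\<epsilon>\<close>, where \<open>\<epsilon> i\<close> holds iff \<open>i\<close> has sign $+$.  The group $B_n$ is represented by
  the maps through which it acts.
\<close>

definition signed_perm_act ::
    "('n \<Rightarrow> 'n) \<Rightarrow> ('n \<Rightarrow> bool) \<Rightarrow> real ^ 'n \<Rightarrow> real ^ 'n" where
  "signed_perm_act \<pi> \<epsilon> x = (\<chi> i. if \<epsilon> i then x $ \<pi> i else 1 - x $ \<pi> i)"

definition signed_perms :: "(real ^ 'n \<Rightarrow> real ^ 'n) set" where
  "signed_perms = {signed_perm_act \<pi> \<epsilon> | \<pi> \<epsilon>. \<pi> permutes UNIV}"

definition equivalent_sets :: "(real ^ 'n) set \<Rightarrow> (real ^ 'n) set \<Rightarrow> bool" where
  "equivalent_sets A B \<longleftrightarrow> (\<exists>w \<in> signed_perms. B = w ` A)"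

definition polytope01_vertices :: "nat \<Rightarrow> (real ^ 'n) set \<Rightarrow> bool" where
  "polytope01_vertices k P \<longleftrightarrow>
     (\<exists>S. S \<subseteq> cube_vertices \<and> S \<noteq> {} \<and> card S = k \<and> P = convex hull S)"

definition polytopes01 :: "(real ^ 'n) set set" where
  "polytopes01 = {convex hull S | S. S \<subseteq> cube_vertices \<and> S \<noteq> {}}"

definition equiv01 :: "((real ^ 'n) set \<times> (real ^ 'n) set) set" where
  "equiv01 = {(P, Q). P \<in> polytopes01 \<and> Q \<in> polytopes01 \<and> equivalent_sets P Q}"

definition classes01 :: "(real ^ 'n) set set set" where
  "classes01 = polytopes01 // equiv01"

definition polytopes01_in :: "(real ^ 'n) set \<Rightarrow> (real ^ 'n) set set" where
  "polytopes01_in X = {P \<in> polytopes01. P \<subseteq> X}"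

definition partial_classes01 :: "(real ^ 'n) set \<Rightarrow> (real ^ 'n) set set set" where
  "partial_classes01 X =
     polytopes01_in X // (equiv01 \<inter> (polytopes01_in X \<times> polytopes01_in X))"

text \<open>
  This is $\mathcal{P}(X, k)$, and \<open>non_full_dim_classes01 k\<close> below is $\mathcal{H}_n(k)$.
  Classes are nonempty, and equivalence preserves both the number of vertices and the dimension,
  so quantifying over all members of a class or over some member makes no difference.
\<close>

definition partial_classes01_card ::
    "(real ^ 'n) set \<Rightarrow> nat \<Rightarrow> (real ^ 'n) set set set" where
  "partial_classes01_card X k =
     {C \<in> partial_classes01 X. \<forall>P \<in> C. polytope01_vertices k P}"

definition non_full_dim_classes01 :: "nat \<Rightarrow> (real ^ 'n) set set set" where
  "non_full_dim_classes01 k =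
     {C \<in> classes01. \<forall>P \<in> C. polytope01_vertices k P \<and> aff_dim P \<noteq> int CARD('n)}"

definition spanned_hyperplane :: "(real ^ 'n) set \<Rightarrow> bool" where
  "spanned_hyperplane H \<longleftrightarrow>
     (\<exists>a b. a \<noteq> 0 \<and> H = {x. a \<bullet> x = b}) \<and> affine hull (H \<inter> cube_vertices) = H"

definition spanned_hyperplanes_ge :: "nat \<Rightarrow> (real ^ 'n) set set" where
  "spanned_hyperplanes_ge k =
     {H. spanned_hyperplane H \<and> card (H \<inter> cube_vertices) \<ge> k}"

text \<open>
  \<open>H 1, \<dots>, H h\<close> contains exactly one member of each equivalence class of spanned
  hyperplanes with at least \<open>k\<close> cube vertices; in particular \<open>h\<close> is the number of classes.
\<close>

definition hyperplane_representatives ::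
    "nat \<Rightarrow> nat \<Rightarrow> (nat \<Rightarrow> (real ^ 'n) set) \<Rightarrow> bool" where
  "hyperplane_representatives k h H \<longleftrightarrow>
     (\<forall>i \<in> {1..h}. H i \<in> spanned_hyperplanes_ge k) \<and>
     (\<forall>G \<in> spanned_hyperplanes_ge k. \<exists>!i. i \<in> {1..h} \<and> equivalent_sets (H i) G)"

text \<open>
  Elements of the disjoint union are pairs \<open>(i, C)\<close> of an index and a partial class.
\<close>

definition Phi :: "nat \<times> (real ^ 'n) set set \<Rightarrow> (real ^ 'n) set set" where
  "Phi = (\<lambda>(i, C). THE D. D \<in> classes01 \<and> C \<subseteq> D)"

end

theory Submission
  imports Defs
begin

text \<open>
  A set of cube vertices of affine dimension $d$ has at most $2^d$ elements: a coordinate that is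
  not constant on the set splits it into two parts of smaller dimension.  Hence a $0/1$-polytope
  $P$ with $k > 2^{n-2}$ vertices that is not full-dimensional has dimension exactly $n - 1$, so
  it lies in exactly one hyperplane, its affine hull, and that hyperplane is spanned.  Since $B_n$
  acts by affine bijections, any $w \in B_n$ with $w(P) = Q$ also maps the hyperplane of $P$ onto
  that of $Q$.  Thus the class of $P$ determines both the representative $H_i$ and the partial
  class in it, and every class is reached by moving the affine hull of a member to its
  representative.
\<close>

section \<open>Affine dimension of sets of cube vertices\<close>

lemma finite_cube_vertices: "finite (cube_vertices :: (real ^ 'n) set)"
proof (rule finite_subset)
  \<comment> \<open>A vertex is recovered from its set of coordinates equal to 1, and there are only
    finitely many such sets.\<close>
  show "cube_vertices \<subseteq> range (\<lambda>B. (\<chi> i. if i \<in> B then 1 else 0) :: real ^ 'n)"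
  proof
    fix x :: "real ^ 'n"
    assume "x \<in> cube_vertices"
    then have "x = (\<chi> i. if i \<in> {i. x $ i = 1} then 1 else 0)"
      by (auto simp: cube_vertices_def vec_eq_iff)
    then show "x \<in> range (\<lambda>B. (\<chi> i. if i \<in> B then 1 else 0) :: real ^ 'n)"
      by blast
  qed
qed simp

text \<open>The affine hull of the slice stays inside the coordinate hyperplane and so misses
  \<open>y\<close>. It is therefore a proper subset of the affine hull of \<open>S\<close>, which
  forces a drop in dimension.\<close>

lemma aff_dim_slice_less:
  fixes S :: "(real ^ 'n) set"
  assumes "y \<in> S" "y $ i \<noteq> c"
  shows "aff_dim {x \<in> S. x $ i = c} < aff_dim S"
proof -
  let ?T = "{x \<in> S. x $ i = c}"
  have "{x :: real ^ 'n. x $ i = c} = {x. axis i 1 \<bullet> x = c}"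
    by (simp add: inner_axis')
  then have "affine {x :: real ^ 'n. x $ i = c}"
    using affine_hyperplane by metis
  then have "affine hull ?T \<subseteq> {x. x $ i = c}"
    by (intro hull_minimal) auto
  moreover have "affine hull ?T \<subseteq> affine hull S"
    by (intro hull_mono) auto
  moreover have "y \<in> affine hull S"
    using assms(1) by (rule hull_inc)
  ultimately have "affine hull ?T \<subset> affine hull S"
    using assms(2) by blast
  then show ?thesis
    by (rule aff_dim_psubset)
qed

text \<open>Strong induction on the dimension: two nonempty slices, each of dimension at most
  \<open>d - 1\<close>, give at most \<open>2 * 2 ^ (d - 1)\<close> points. Singletons need no
  splitting.\<close>

lemma card_cube_vertices_le:
  fixes S :: "(real ^ 'n) set"
  assumes "S \<subseteq> cube_vertices" "S \<noteq> {}"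
  shows "card S \<le> 2 ^ nat (aff_dim S)"
  using assms
proof (induction "nat (aff_dim S)" arbitrary: S rule: less_induct)
  case less
  show ?case
  proof (cases "\<exists>x\<in>S. \<exists>y\<in>S. x \<noteq> y")
    case False
    with less.prems(2) have "is_singleton S"
      by (auto intro!: is_singletonI')
    then show ?thesis
      by (simp add: is_singleton_altdef)
  next
    case True
    then obtain x y i where xy: "x \<in> S" "y \<in> S" "x $ i \<noteq> y $ i"
      by (auto simp: vec_eq_iff)
    define T where "T c = {z \<in> S. z $ i = c}" for c
    have S: "S = T 0 \<union> T 1"
      using less.prems(1) by (auto simp: T_def cube_vertices_def)
    have fin: "finite S"
      using less.prems(1) finite_cube_vertices finite_subset by blast
    \<comment> \<open>Positivity of the dimension is recorded along with the bound, since only then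
      does doubling \<open>2 ^ (d - 1)\<close> give \<open>2 ^ d\<close> with truncated
      subtraction.\<close>
    have slice: "card (T c) \<le> 2 ^ (nat (aff_dim S) - 1) \<and> nat (aff_dim S) > 0"
      if "c \<in> {0, 1}" for c
    proof -
      \<comment> \<open>As \<open>x\<close> and \<open>y\<close> differ at \<open>i\<close>, one has
        value 0 there and the other 1: each slice contains one of them and omits the other.\<close>
      have "x $ i \<in> {0, 1}" "y $ i \<in> {0, 1}"
        using xy less.prems(1) by (auto simp: cube_vertices_def)
      then have "T c \<noteq> {}"
        using xy that by (auto simp: T_def)
      moreover have "\<exists>z\<in>S. z $ i \<noteq> c"
        using xy by metis
      ultimately have less_dim: "aff_dim (T c) < aff_dim S"
        unfolding T_def using aff_dim_slice_less by blast
      \<comment> \<open>Nonemptiness excludes dimension -1, which \<open>nat\<close> would identify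
        with 0; hence the strict inequality survives \<open>nat\<close>.\<close>
      have "aff_dim (T c) \<ge> 0"
        using \<open>T c \<noteq> {}\<close> aff_dim_negative_iff[of "T c"] by linarith
      with less_dim have lt: "nat (aff_dim (T c)) < nat (aff_dim S)"
        by simp
      have "card (T c) \<le> 2 ^ nat (aff_dim (T c))"
        using less.hyps[OF lt] less.prems(1) \<open>T c \<noteq> {}\<close> by (auto simp: T_def)
      also have "\<dots> \<le> 2 ^ (nat (aff_dim S) - 1)"
        using lt by (intro power_increasing) auto
      finally show ?thesis
        using lt by auto
    qed
    have "card S \<le> card (T 0) + card (T 1)"
      using S card_Un_le by metis
    also have "\<dots> \<le> 2 * 2 ^ (nat (aff_dim S) - 1)"
      using slice[of 0] slice[of 1] by simp
    also have "\<dots> = 2 ^ nat (aff_dim S)"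
      using slice[of 0] by (simp flip: power_Suc)
    finally show ?thesis .
  qed
qed

text \<open>This is where the lower bound on \<open>k\<close> enters: too many vertices for
  dimension \<open>n - 2\<close> force dimension at least \<open>n - 1\<close>.\<close>

lemma polytope01_vertices_aff_dim_ge:
  fixes P :: "(real ^ 'n) set"
  assumes "CARD('n) \<ge> 2" "2 ^ (CARD('n) - 2) < k" "polytope01_vertices k P"
  shows "aff_dim P \<ge> int CARD('n) - 1"
proof -
  obtain S where S: "S \<subseteq> cube_vertices" "S \<noteq> {}" "card S = k" "P = convex hull S"
    using assms(3) by (auto simp: polytope01_vertices_def)
  have "2 ^ (CARD('n) - 2) < (2 :: nat) ^ nat (aff_dim S)"
    using card_cube_vertices_le[OF S(1,2)] S(3) assms(2) by linarith
  then have "CARD('n) - 2 < nat (aff_dim S)"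
    by simp
  then show ?thesis
    using assms(1) S(4) by (simp add: aff_dim_convex_hull)
qed

text \<open>Nested nonempty affine sets of equal dimension coincide. This makes the hyperplane
  around \<open>P\<close> recoverable from \<open>P\<close> alone.\<close>

lemma affine_hull_eq_hyperplane:
  fixes P :: "(real ^ 'n) set"
  assumes "a \<noteq> 0" "P \<subseteq> {x. a \<bullet> x = b}" "P \<noteq> {}" "aff_dim P \<ge> int CARD('n) - 1"
  shows "affine hull P = {x. a \<bullet> x = b}"
proof (rule affine_dim_equal)
  show "affine hull P \<subseteq> {x. a \<bullet> x = b}"
    using assms(2) by (intro hull_minimal) (auto simp: affine_hyperplane)
  have "aff_dim P \<le> aff_dim {x. a \<bullet> x = b}"
    using assms(2) by (rule aff_dim_subset)
  then show "aff_dim (affine hull P) = aff_dim {x. a \<bullet> x = b}"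
    using assms(1,4) by (simp add: aff_dim_hyperplane)
qed (use assms(3) in \<open>auto simp: affine_hyperplane\<close>)

section \<open>The action of signed permutations\<close>

lemma signed_permsE:
  assumes "w \<in> signed_perms"
  obtains \<pi> \<epsilon> where "\<pi> permutes UNIV" "w = signed_perm_act \<pi> \<epsilon>"
  using assms by (auto simp: signed_perms_def)

lemma id_in_signed_perms: "id \<in> signed_perms"
proof -
  have "id = signed_perm_act id (\<lambda>_. True)"
    by (auto simp: signed_perm_act_def fun_eq_iff)
  then show ?thesis
    unfolding signed_perms_def using permutes_id by blast
qed

lemma comp_in_signed_perms:
  assumes "v \<in> signed_perms" "w \<in> signed_perms"
  shows "v \<circ> w \<in> signed_perms"
proof -
  obtain \<pi> \<epsilon> where v: "\<pi> permutes UNIV" "v = signed_perm_act \<pi> \<epsilon>"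
    using assms(1) by (rule signed_permsE)
  obtain \<sigma> \<delta> where w: "\<sigma> permutes UNIV" "w = signed_perm_act \<sigma> \<delta>"
    using assms(2) by (rule signed_permsE)
  \<comment> \<open>Two reflections \<open>t \<mapsto> 1 - t\<close> cancel, so the composite sign
    is + exactly when the two signs agree.\<close>
  have "v \<circ> w = signed_perm_act (\<sigma> \<circ> \<pi>) (\<lambda>i. \<epsilon> i = \<delta> (\<pi> i))"
    using v(2) w(2) by (auto simp: signed_perm_act_def fun_eq_iff vec_eq_iff)
  then show ?thesis
    unfolding signed_perms_def using permutes_compose[OF v(1) w(1)] by blast
qed

lemma signed_perms_inverse:
  assumes "w \<in> signed_perms"
  obtains v where "v \<in> signed_perms" "v \<circ> w = id" "w \<circ> v = id"
proof -
  obtain \<pi> \<epsilon> where w: "\<pi> permutes UNIV" "w = signed_perm_act \<pi> \<epsilon>"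
    using assms by (rule signed_permsE)
  \<comment> \<open>A reflection is its own inverse, so the inverse keeps the signs and only moves
    them along \<open>inv \<pi>\<close>.\<close>
  let ?v = "signed_perm_act (inv \<pi>) (\<lambda>i. \<epsilon> (inv \<pi> i))"
  show ?thesis
  proof (rule that[of ?v])
    show "?v \<in> signed_perms"
      unfolding signed_perms_def using permutes_inv[OF w(1)] by blast
    show "?v \<circ> w = id" "w \<circ> ?v = id"
      using w(2) permutes_inverses[OF w(1)]
      by (auto simp: signed_perm_act_def fun_eq_iff vec_eq_iff)
  qed
qed

lemma signed_perms_bij: "w \<in> signed_perms \<Longrightarrow> bij w"
  using signed_perms_inverse o_bij by metis

text \<open>Writing \<open>1 - t\<close> as the constant 1 plus the linear term \<open>- t\<close>
  reduces hulls and dimension of images to injective linear maps and translations.\<close>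

lemma signed_perms_affine:
  fixes w :: "real ^ 'n \<Rightarrow> real ^ 'n"
  assumes "w \<in> signed_perms"
  obtains f c where "linear f" "inj f" "w = (\<lambda>x. c + f x)"
proof -
  obtain \<pi> \<epsilon> where w: "w = signed_perm_act \<pi> \<epsilon>"
    using assms by (rule signed_permsE)
  define f :: "real ^ 'n \<Rightarrow> real ^ 'n"
    where "f x = (\<chi> i. if \<epsilon> i then x $ \<pi> i else - x $ \<pi> i)" for x
  define c :: "real ^ 'n" where "c = (\<chi> i. if \<epsilon> i then 0 else 1)"
  have weq: "w = (\<lambda>x. c + f x)"
    by (auto simp: w f_def c_def signed_perm_act_def fun_eq_iff vec_eq_iff)
  moreover have "linear f"
    by (rule linearI) (auto simp: f_def vec_eq_iff)
  moreover have "inj f"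
    using bij_is_inj[OF signed_perms_bij[OF assms]] by (auto simp: weq inj_def)
  ultimately show ?thesis
    using that by blast
qed

lemma signed_perms_convex_hull:
  fixes S :: "(real ^ 'n) set"
  assumes "w \<in> signed_perms"
  shows "w ` (convex hull S) = convex hull (w ` S)"
proof -
  obtain f c where f: "linear f" "w = (\<lambda>x. c + f x)"
    using assms by (rule signed_perms_affine)
  have "w ` A = (+) c ` f ` A" for A
    by (auto simp: f(2))
  then show ?thesis
    using convex_hull_linear_image[OF f(1), of S] by (simp only: convex_hull_translation)
qed

lemma signed_perms_affine_hull:
  fixes S :: "(real ^ 'n) set"
  assumes "w \<in> signed_perms"
  shows "w ` (affine hull S) = affine hull (w ` S)"
proof -
  obtain f c where f: "linear f" "w = (\<lambda>x. c + f x)"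
    using assms by (rule signed_perms_affine)
  have "w ` A = (+) c ` f ` A" for A
    by (auto simp: f(2))
  then show ?thesis
    using f(1) by (simp add: affine_hull_translation affine_hull_linear_image linear_conv_bounded_linear)
qed

lemma signed_perms_aff_dim:
  fixes S :: "(real ^ 'n) set"
  assumes "w \<in> signed_perms"
  shows "aff_dim (w ` S) = aff_dim S"
proof -
  obtain f c where f: "linear f" "inj f" "w = (\<lambda>x. c + f x)"
    using assms by (rule signed_perms_affine)
  have "w ` S = (+) c ` f ` S"
    by (auto simp: f(3))
  then show ?thesis
    using f(1,2) by (simp add: aff_dim_translation_eq aff_dim_injective_linear_image)
qed

lemma signed_perms_cube_vertices:
  assumes "w \<in> signed_perms" "S \<subseteq> cube_vertices"
  shows "w ` S \<subseteq> cube_vertices"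
  using assms by (fastforce simp: signed_perms_def signed_perm_act_def cube_vertices_def)

lemma signed_perms_polytope01_vertices:
  assumes "w \<in> signed_perms" "polytope01_vertices k P"
  shows "polytope01_vertices k (w ` P)"
proof -
  obtain S where S: "S \<subseteq> cube_vertices" "S \<noteq> {}" "card S = k" "P = convex hull S"
    using assms(2) by (auto simp: polytope01_vertices_def)
  have "inj_on w S"
    using signed_perms_bij[OF assms(1)] bij_is_inj inj_on_subset by blast
  then have "card (w ` S) = k"
    using S(3) by (simp add: card_image)
  then show ?thesis
    unfolding polytope01_vertices_def
    using S signed_perms_cube_vertices[OF assms(1) S(1)] signed_perms_convex_hull[OF assms(1)]
    by (intro exI[of _ "w ` S"]) auto
qed

lemma signed_perms_polytopes01:
  assumes "w \<in> signed_perms" "P \<in> polytopes01"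
  shows "w ` P \<in> polytopes01"
proof -
  obtain S where S: "S \<subseteq> cube_vertices" "S \<noteq> {}" "P = convex hull S"
    using assms(2) by (auto simp: polytopes01_def)
  then show ?thesis
    unfolding polytopes01_def
    using signed_perms_cube_vertices[OF assms(1) S(1)] signed_perms_convex_hull[OF assms(1)]
    by blast
qed

section \<open>Equivalence classes\<close>

lemma equivalent_sets_refl: "equivalent_sets A A"
  unfolding equivalent_sets_def using id_in_signed_perms by (intro bexI[of _ id]) auto

lemma equivalent_sets_sym:
  assumes "equivalent_sets A B"
  shows "equivalent_sets B A"
proof -
  obtain w where w: "w \<in> signed_perms" "B = w ` A"
    using assms by (auto simp: equivalent_sets_def)
  obtain v where "v \<in> signed_perms" "v \<circ> w = id"
    using w(1) by (rule signed_perms_inverse)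
  moreover from this have "A = v ` B"
    by (simp add: w(2) image_comp)
  ultimately show ?thesis
    by (auto simp: equivalent_sets_def)
qed

lemma equivalent_sets_trans:
  assumes "equivalent_sets A B" "equivalent_sets B C"
  shows "equivalent_sets A C"
proof -
  obtain v w where "v \<in> signed_perms" "B = v ` A" "w \<in> signed_perms" "C = w ` B"
    using assms by (auto simp: equivalent_sets_def)
  then have "w \<circ> v \<in> signed_perms" "C = (w \<circ> v) ` A"
    by (auto simp: comp_in_signed_perms image_comp)
  then show ?thesis
    unfolding equivalent_sets_def by blast
qed

lemma equiv_equiv01: "equiv polytopes01 equiv01"
proof (rule equivI)
  show "equiv01 \<subseteq> polytopes01 \<times> polytopes01"
    by (auto simp: equiv01_def)
  show "refl_on polytopes01 equiv01"
    by (rule refl_onI) (simp add: equiv01_def equivalent_sets_refl)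
  show "sym equiv01"
    by (rule symI) (simp add: equiv01_def equivalent_sets_sym)
  show "trans equiv01"
    by (rule transI) (use equivalent_sets_trans in \<open>auto simp: equiv01_def\<close>)
qed

section \<open>Partial classes and the full classes containing them\<close>

lemma equiv_partial: "equiv (polytopes01_in X) (equiv01 \<inter> (polytopes01_in X \<times> polytopes01_in X))"
proof -
  have "polytopes01_in X \<subseteq> polytopes01"
    by (auto simp: polytopes01_in_def)
  then show ?thesis
    using equiv_equiv01 unfolding equiv_def refl_on_def sym_def trans_def by blast
qed

lemma quotient_eq_class:
  assumes "equiv A r" "X \<in> A // r" "x \<in> X"
  shows "X = r `` {x}"
proof -
  obtain a where "X = r `` {a}"
    using assms(2) by (rule quotientE)
  then show ?thesis
    using assms(1,3) equiv_class_eq by fastforce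
qed

text \<open>Full classes are disjoint, so any one member of \<open>C\<close> pins down the class
  around it. The equivalence form yields existence and uniqueness at once, and also evaluates the
  description in \<open>Phi\<close>.\<close>

lemma class_containing_partial_class:
  assumes "C \<in> partial_classes01 X" "P \<in> C"
  shows "D \<in> classes01 \<and> C \<subseteq> D \<longleftrightarrow> D = equiv01 `` {P}"
proof -
  have C: "C = (equiv01 \<inter> (polytopes01_in X \<times> polytopes01_in X)) `` {P}"
    using assms quotient_eq_class[OF equiv_partial] unfolding partial_classes01_def by blast
  then have "P \<in> polytopes01"
    using assms(2) by (auto simp: polytopes01_in_def)
  then have "equiv01 `` {P} \<in> classes01"
    by (auto simp: classes01_def quotientI)
  moreover have "C \<subseteq> equiv01 `` {P}"
    using C by auto
  moreover have "D = equiv01 `` {P}" if "D \<in> classes01" "P \<in> D" for D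
    using that quotient_eq_class[OF equiv_equiv01] unfolding classes01_def by blast
  ultimately show ?thesis
    using assms(2) by blast
qed

lemma partial_class_nonempty: "C \<in> partial_classes01 X \<Longrightarrow> \<exists>P. P \<in> C"
  unfolding partial_classes01_def using in_quotient_imp_non_empty[OF equiv_partial] by blast

lemma partial_class_subset: "C \<in> partial_classes01 X \<Longrightarrow> P \<in> C \<Longrightarrow> P \<in> polytopes01_in X"
  unfolding partial_classes01_def using in_quotient_imp_subset[OF equiv_partial] by blast

lemma Phi_eq:
  assumes "C \<in> partial_classes01 X" "P \<in> C"
  shows "Phi (i, C) = equiv01 `` {P}"
  using class_containing_partial_class[OF assms] by (simp add: Phi_def)

section \<open>Bijectivity of \<open>Phi\<close>: well-definedness, injectivity, image,
  surjectivity\<close>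

theorem theorem4p1:
  fixes k h :: nat and H :: "nat \<Rightarrow> (real ^ 'n) set"
  assumes "CARD('n) \<ge> 2"
    and "2 ^ (CARD('n) - 2) < k" and "k \<le> 2 ^ (CARD('n) - 1)"
    and "hyperplane_representatives k h H"
  shows "(\<forall>i \<in> {1..h}. \<forall>C \<in> partial_classes01_card (H i) k.
            \<exists>!D. D \<in> classes01 \<and> C \<subseteq> D) \<and>
         bij_betw Phi (SIGMA i : {1..h}. partial_classes01_card (H i) k)
           (non_full_dim_classes01 k)"
proof (intro conjI)
  show "\<forall>i \<in> {1..h}. \<forall>C \<in> partial_classes01_card (H i) k. \<exists>!D. D \<in> classes01 \<and> C \<subseteq> D"
  proof (intro ballI)
    fix i C
    assume "C \<in> partial_classes01_card (H i) k"
    then have C: "C \<in> partial_classes01 (H i)"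
      by (simp add: partial_classes01_card_def)
    then obtain P where "P \<in> C"
      using partial_class_nonempty by blast
    then show "\<exists>!D. D \<in> classes01 \<and> C \<subseteq> D"
      using class_containing_partial_class[OF C] by simp
  qed

  have H_in: "H i \<in> spanned_hyperplanes_ge k" if "i \<in> {1..h}" for i
    using assms(4) that by (auto simp: hyperplane_representatives_def)
  have H_unique: "\<exists>!i. i \<in> {1..h} \<and> equivalent_sets (H i) G" if "G \<in> spanned_hyperplanes_ge k" for G
    using assms(4) that by (auto simp: hyperplane_representatives_def)
  have dim_ge: "aff_dim P \<ge> int CARD('n) - 1" if "polytope01_vertices k P" for P :: "(real ^ 'n) set"
    using polytope01_vertices_aff_dim_ge[OF assms(1,2) that] .

  \<comment> \<open>Each polytope counted in \<open>H i\<close> spans it, so \<open>P\<close>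
    determines its representative hyperplane and cannot be full-dimensional.\<close>
  have hull: "affine hull P = H i \<and> aff_dim P = int CARD('n) - 1"
    if i: "i \<in> {1..h}" and P: "polytope01_vertices k P" "P \<subseteq> H i" for i P
  proof -
    obtain a b where ab: "a \<noteq> 0" "H i = {x. a \<bullet> x = b}"
      using H_in[OF i] by (auto simp: spanned_hyperplanes_ge_def spanned_hyperplane_def)
    have "P \<noteq> {}"
      using P(1) by (auto simp: polytope01_vertices_def)
    then have "affine hull P = H i"
      using affine_hull_eq_hyperplane[OF ab(1) _ _ dim_ge[OF P(1)]] P(2) ab(2) by simp
    moreover from this have "aff_dim P = int CARD('n) - 1"
      using aff_dim_affine_hull[of P] ab by (simp add: aff_dim_hyperplane)
    ultimately show ?thesis
      by simp
  qed

  have member: "P \<in> polytopes01 \<and> P \<subseteq> H i \<and> polytope01_vertices k P"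
    if "C \<in> partial_classes01_card (H i) k" "P \<in> C" for i C P
    using that partial_class_subset by (auto simp: partial_classes01_card_def polytopes01_in_def)

  show "bij_betw Phi (SIGMA i : {1..h}. partial_classes01_card (H i) k) (non_full_dim_classes01 k)"
    unfolding bij_betw_def
  proof (intro conjI equalityI subsetI)
    show "inj_on Phi (SIGMA i : {1..h}. partial_classes01_card (H i) k)"
    proof (rule inj_onI, clarify)
      fix i C j C'
      assume i: "i \<in> {1..h}" and C: "C \<in> partial_classes01_card (H i) k"
        and j: "j \<in> {1..h}" and C': "C' \<in> partial_classes01_card (H j) k"
        and eq: "Phi (i, C) = Phi (j, C')"
      have partial: "C \<in> partial_classes01 (H i)" "C' \<in> partial_classes01 (H j)"
        using C C' by (auto simp: partial_classes01_card_def)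
      obtain P Q where P: "P \<in> C" and Q: "Q \<in> C'"
        using partial partial_class_nonempty by blast
      have "equiv01 `` {P} = equiv01 `` {Q}"
        using eq Phi_eq[OF partial(1) P] Phi_eq[OF partial(2) Q] by simp
      then have PQ: "(P, Q) \<in> equiv01"
        using member[OF C' Q] eq_equiv_class[OF _ equiv_equiv01] by blast
      then obtain w where w: "w \<in> signed_perms" "Q = w ` P"
        by (auto simp: equiv01_def equivalent_sets_def)
      \<comment> \<open>\<open>w\<close> commutes with affine hulls, and the hulls of
        \<open>P\<close> and \<open>Q\<close> are \<open>H i\<close> and \<open>H j\<close>.\<close>
      have "H j = w ` H i"
        using hull[OF i, of P] hull[OF j, of Q] member[OF C P] member[OF C' Q]
          signed_perms_affine_hull[OF w(1), of P] w(2) by simp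
      then have "equivalent_sets (H i) (H j)"
        using w(1) by (auto simp: equivalent_sets_def)
      \<comment> \<open>Both \<open>H i\<close> and \<open>H j\<close> are equivalent to
        \<open>H j\<close>, whose representative is unique.\<close>
      then have ij: "i = j"
        using H_unique[OF H_in[OF j]] equivalent_sets_refl i j by blast
      have "(P, Q) \<in> equiv01 \<inter> (polytopes01_in (H i) \<times> polytopes01_in (H i))"
        using PQ partial_class_subset[OF partial(1) P] partial_class_subset[OF partial(2) Q] ij
        by simp
      then have "C = C'"
        using quotient_eqI[OF equiv_partial _ _ P Q] partial ij
        by (simp add: partial_classes01_def)
      with ij show "i = j \<and> C = C'"
        by simp
    qed
  next
    fix D
    assume "D \<in> Phi ` (SIGMA i : {1..h}. partial_classes01_card (H i) k)"
    then obtain i C where i: "i \<in> {1..h}" and C: "C \<in> partial_classes01_card (H i) k"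
      and D: "D = Phi (i, C)"
      by auto
    have partial: "C \<in> partial_classes01 (H i)"
      using C by (auto simp: partial_classes01_card_def)
    obtain P where P: "P \<in> C"
      using partial partial_class_nonempty by blast
    have D': "D = equiv01 `` {P}"
      using D Phi_eq[OF partial P] by simp
    \<comment> \<open>\<open>D\<close> may have members outside \<open>H i\<close>; they inherit
      vertex number and dimension from \<open>P\<close> through \<open>w\<close>.\<close>
    moreover have "polytope01_vertices k Q \<and> aff_dim Q \<noteq> int CARD('n)" if Q: "Q \<in> D" for Q
    proof -
      obtain w where "w \<in> signed_perms" "Q = w ` P"
        using Q D' by (auto simp: equiv01_def equivalent_sets_def)
      then show ?thesis
        using member[OF C P] hull[OF i, of P] signed_perms_polytope01_vertices
        by (auto simp: signed_perms_aff_dim)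
    qed
    ultimately show "D \<in> non_full_dim_classes01 k"
      using class_containing_partial_class[OF partial P, of D]
      by (auto simp: non_full_dim_classes01_def)
  next
    fix D :: "(real ^ 'n) set set"
    assume D: "D \<in> non_full_dim_classes01 k"
    then have "D \<in> polytopes01 // equiv01"
      by (simp add: non_full_dim_classes01_def classes01_def)
    then obtain P where P: "P \<in> polytopes01" "D = equiv01 `` {P}"
      by (rule quotientE)
    then have "P \<in> D"
      using equiv_class_self[OF equiv_equiv01] by blast
    then have vert: "polytope01_vertices k P" and "aff_dim P \<noteq> int CARD('n)"
      using D by (auto simp: non_full_dim_classes01_def)
    \<comment> \<open>The dimension lies between \<open>n - 1\<close> and \<open>n\<close>, and
      \<open>n\<close> is excluded.\<close>
    then have dim: "aff_dim P = int CARD('n) - 1"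
      using dim_ge[OF vert] aff_dim_le_DIM[of P] by simp
    obtain S where S: "S \<subseteq> cube_vertices" "card S = k" "P = convex hull S"
      using vert by (auto simp: polytope01_vertices_def)
    define G where "G = affine hull P"
    have G_S: "G = affine hull S"
      by (simp add: G_def S(3) affine_hull_convex_hull)
    \<comment> \<open>The inclusion squeezes the hull of \<open>G \<inter> cube_vertices\<close>
      between the hull of \<open>S\<close> and \<open>G\<close>, which are equal. So
      \<open>G\<close> is spanned, and it has at least \<open>k\<close> vertices.\<close>
    have "S \<subseteq> G \<inter> cube_vertices"
      using S(1) hull_subset[of S] G_S by auto
    moreover have "affine hull (G \<inter> cube_vertices) \<subseteq> G"
      by (intro hull_minimal) (auto simp: G_def)
    ultimately have "affine hull (G \<inter> cube_vertices) = G"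
      using G_S hull_mono[of S "G \<inter> cube_vertices" affine] by auto
    moreover have "\<exists>a b. a \<noteq> 0 \<and> G = {x. a \<bullet> x = b}"
      using dim aff_dim_eq_hyperplane[of P] by (auto simp: G_def)
    moreover have "card (G \<inter> cube_vertices) \<ge> k"
      using card_mono[OF _ \<open>S \<subseteq> G \<inter> cube_vertices\<close>] finite_cube_vertices S(2) by auto
    ultimately have "G \<in> spanned_hyperplanes_ge k"
      by (simp add: spanned_hyperplanes_ge_def spanned_hyperplane_def)
    then obtain i where i: "i \<in> {1..h}" "equivalent_sets (H i) G"
      using H_unique by blast
    obtain w where w: "w \<in> signed_perms" "H i = w ` G"
      using equivalent_sets_sym[OF i(2)] by (auto simp: equivalent_sets_def)
    \<comment> \<open>Moving \<open>G\<close> to its representative carries \<open>P\<close> into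
      \<open>H i\<close> without leaving its class; the partial class of \<open>Q\<close> is the
      preimage of \<open>D\<close>.\<close>
    define Q where "Q = w ` P"
    have Q: "Q \<in> polytopes01" "Q \<subseteq> H i" "equivalent_sets P Q"
      using signed_perms_polytopes01[OF w(1) P(1)] w hull_subset[of P affine]
      by (auto simp: Q_def G_def equivalent_sets_def)
    define C where "C = (equiv01 \<inter> (polytopes01_in (H i) \<times> polytopes01_in (H i))) `` {Q}"
    have Q_in: "Q \<in> polytopes01_in (H i)"
      using Q by (simp add: polytopes01_in_def)
    then have partial: "C \<in> partial_classes01 (H i)" and QC: "Q \<in> C"
      using equiv_class_self[OF equiv_partial] by (auto simp: C_def partial_classes01_def quotientI)
    have "(P, Q) \<in> equiv01"
      using Q P(1) by (simp add: equiv01_def)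
    then have DQ: "D = equiv01 `` {Q}"
      using P(2) equiv_class_eq[OF equiv_equiv01] by simp
    then have "C \<subseteq> D"
      by (auto simp: C_def)
    \<comment> \<open>The vertex number is known for every member of \<open>D\<close>, hence for
      every member of \<open>C\<close>.\<close>
    then have "C \<in> partial_classes01_card (H i) k"
      using partial D by (auto simp: partial_classes01_card_def non_full_dim_classes01_def)
    moreover have "D = Phi (i, C)"
      using Phi_eq[OF partial QC] DQ by simp
    ultimately show "D \<in> Phi ` (SIGMA i : {1..h}. partial_classes01_card (H i) k)"
      using i(1) by blast
  qed
qed

end
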